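(* Let $T>0$. Then $\overline{\mathbf R_T}=L^2(\mathbb R_+)$, where the closure is taken in $L^2(\mathbb R_+)$.
   Context: $\mathbb R_+=(0,+\infty)$; $L^2(\mathbb R_+)$ and $L^\infty(0,T)$ are spaces over the same scalar field $\mathbb C$. $\mathbf R_T$ is the set of all functions $Y\in L^2(\mathbb R_+)$ for which there is $u\in L^\infty(0,T)$ such that $$Y(r)=-\frac1\pi\int_0^T\frac1{2\xi}e^{-\frac r{4\xi}}u(T-\xi)\,d\xi,\quad r\in\mathbb R_+.$$ *)

theory Defs
  imports "HOL-Analysis.Analysis"
begin

abbreviation Rplus :: "real measure" where
  "Rplus \<equiv> lebesgue_on {0<..}"

definition square_integrable :: "(real \<Rightarrow> complex) \<Rightarrow> bool" where
  "square_integrable f \<longleftrightarrow>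
     f \<in> borel_measurable Rplus \<and> integrable Rplus (\<lambda>r. (cmod (f r))\<^sup>2)"

definition L2_rel :: "(real \<Rightarrow> complex) \<Rightarrow> (real \<Rightarrow> complex) \<Rightarrow> bool" where
  "L2_rel f g \<longleftrightarrow> square_integrable f \<and> square_integrable g \<and> (AE r in Rplus. f r = g r)"

lemma square_integrable_zero: "square_integrable (\<lambda>_. 0)"
  by (simp add: square_integrable_def)

lemma square_integrable_scale:
  assumes "square_integrable f"
  shows "square_integrable (\<lambda>r. c * f r)"
  using assms by (auto simp: square_integrable_def norm_mult power_mult_distrib)

lemma square_integrable_add:
  assumes "square_integrable f" "square_integrable g"
  shows "square_integrable (\<lambda>r. f r + g r)"
proof -
  have m: "f \<in> borel_measurable Rplus" "g \<in> borel_measurable Rplus"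
    using assms by (auto simp: square_integrable_def)
  have "integrable Rplus (\<lambda>r. (cmod (f r + g r))\<^sup>2)"
  proof (rule Bochner_Integration.integrable_bound)
    show "integrable Rplus (\<lambda>r. 2 * (cmod (f r))\<^sup>2 + 2 * (cmod (g r))\<^sup>2)"
      using assms by (auto simp: square_integrable_def)
    show "(\<lambda>r. (cmod (f r + g r))\<^sup>2) \<in> borel_measurable Rplus"
      using m by measurable
    have "(cmod (a + b))\<^sup>2 \<le> 2 * (cmod a)\<^sup>2 + 2 * (cmod b)\<^sup>2" for a b
    proof -
      have "(cmod (a + b))\<^sup>2 \<le> (cmod a + cmod b)\<^sup>2"
        by (intro power_mono norm_triangle_ineq) simp
      also have "\<dots> \<le> 2 * (cmod a)\<^sup>2 + 2 * (cmod b)\<^sup>2"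
        using sum_squares_bound[of "cmod a" "cmod b"] by (simp add: power2_sum)
      finally show ?thesis .
    qed
    then show "AE r in Rplus. norm ((cmod (f r + g r))\<^sup>2)
        \<le> norm (2 * (cmod (f r))\<^sup>2 + 2 * (cmod (g r))\<^sup>2)"
      by simp
  qed
  with m show ?thesis by (simp add: square_integrable_def)
qed

lemma square_integrable_inner:
  assumes "square_integrable f" "square_integrable g"
  shows "integrable Rplus (\<lambda>r. f r \<bullet> g r)"
proof (rule Bochner_Integration.integrable_bound)
  show "integrable Rplus (\<lambda>r. (cmod (f r))\<^sup>2 + (cmod (g r))\<^sup>2)"
    using assms by (auto simp: square_integrable_def)
  show "(\<lambda>r. f r \<bullet> g r) \<in> borel_measurable Rplus"
    using assms by (auto simp: square_integrable_def)
  have "\<bar>a \<bullet> b\<bar> \<le> (cmod a)\<^sup>2 + (cmod b)\<^sup>2" for a b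
  proof -
    have "\<bar>a \<bullet> b\<bar> \<le> cmod a * cmod b" by (rule Cauchy_Schwarz_ineq2)
    moreover have "0 \<le> cmod a * cmod b" by simp
    ultimately show ?thesis
      using sum_squares_bound[of "cmod a" "cmod b"] by linarith
  qed
  then show "AE r in Rplus. norm (f r \<bullet> g r) \<le> norm ((cmod (f r))\<^sup>2 + (cmod (g r))\<^sup>2)"
    by simp
qed

lemma L2_rel_equivp: "part_equivp L2_rel"
proof (rule part_equivpI)
  show "\<exists>f. L2_rel f f"
    using square_integrable_zero by (auto simp: L2_rel_def)
  show "symp L2_rel"
    by (auto simp: symp_def L2_rel_def elim: AE_mp)
  show "transp L2_rel"
    by (auto simp: transp_def L2_rel_def)
qed

quotient_type L2_Rplus = "real \<Rightarrow> complex" / partial: L2_rel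
  by (rule L2_rel_equivp)

text \<open>
  The inner product below is the real part of the usual sesquilinear one; it induces
  the usual norm of the complex space.
\<close>

instantiation L2_Rplus :: real_inner
begin

lift_definition zero_L2_Rplus :: L2_Rplus is "\<lambda>_. 0"
  by (simp add: L2_rel_def square_integrable_zero)

lift_definition plus_L2_Rplus :: "L2_Rplus \<Rightarrow> L2_Rplus \<Rightarrow> L2_Rplus" is "\<lambda>f g r. f r + g r"
  by (auto simp: L2_rel_def intro: square_integrable_add)

lift_definition uminus_L2_Rplus :: "L2_Rplus \<Rightarrow> L2_Rplus" is "\<lambda>f r. - f r"
  by (auto simp: L2_rel_def dest: square_integrable_scale[where c = "-1"])

definition minus_L2_Rplus :: "L2_Rplus \<Rightarrow> L2_Rplus \<Rightarrow> L2_Rplus" where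
  "X - Y = X + - (Y :: L2_Rplus)"

lift_definition scaleR_L2_Rplus :: "real \<Rightarrow> L2_Rplus \<Rightarrow> L2_Rplus"
  is "\<lambda>c f r. complex_of_real c * f r"
  by (auto simp: L2_rel_def intro: square_integrable_scale)

lift_definition inner_L2_Rplus :: "L2_Rplus \<Rightarrow> L2_Rplus \<Rightarrow> real"
  is "\<lambda>f g. LINT r|Rplus. f r \<bullet> g r"
  by (rule integral_cong_AE) (auto simp: L2_rel_def square_integrable_def)

lift_definition norm_L2_Rplus :: "L2_Rplus \<Rightarrow> real"
  is "\<lambda>f. sqrt (LINT r|Rplus. (cmod (f r))\<^sup>2)"
  by (rule arg_cong[of _ _ sqrt], rule integral_cong_AE)
     (auto simp: L2_rel_def square_integrable_def)

definition sgn_L2_Rplus :: "L2_Rplus \<Rightarrow> L2_Rplus" where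
  "sgn_L2_Rplus X = scaleR (inverse (norm X)) X"

definition dist_L2_Rplus :: "L2_Rplus \<Rightarrow> L2_Rplus \<Rightarrow> real" where
  "dist_L2_Rplus X Y = norm (X - Y)"

definition uniformity_L2_Rplus :: "(L2_Rplus \<times> L2_Rplus) filter" where
  "uniformity_L2_Rplus = (INF e\<in>{0<..}. principal {(X, Y). dist X Y < e})"

definition open_L2_Rplus :: "L2_Rplus set \<Rightarrow> bool" where
  "open_L2_Rplus U \<longleftrightarrow> (\<forall>X\<in>U. eventually (\<lambda>(X', Y). X' = X \<longrightarrow> Y \<in> U) uniformity)"

instance
proof
  fix X Y Z :: L2_Rplus and a b :: real
  show "X + Y + Z = X + (Y + Z)"
    by transfer (auto simp: L2_rel_def add.assoc intro!: square_integrable_add)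
  show "X + Y = Y + X"
    by transfer (auto simp: L2_rel_def add.commute intro!: square_integrable_add)
  show "0 + X = X"
    by transfer (auto simp: L2_rel_def)
  show "- X + X = 0"
    by transfer (auto simp: L2_rel_def square_integrable_zero)
  show "X - Y = X + - Y"
    by (rule minus_L2_Rplus_def)
  show "a *\<^sub>R (X + Y) = a *\<^sub>R X + a *\<^sub>R Y"
    by transfer (auto simp: L2_rel_def distrib_left
        intro!: square_integrable_add square_integrable_scale)
  show "(a + b) *\<^sub>R X = a *\<^sub>R X + b *\<^sub>R X"
    by transfer (auto simp: L2_rel_def distrib_right
        intro!: square_integrable_add square_integrable_scale)
  show "a *\<^sub>R b *\<^sub>R X = (a * b) *\<^sub>R X"
    by transfer (auto simp: L2_rel_def mult.assoc intro!: square_integrable_scale)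
  show "1 *\<^sub>R X = X"
    by transfer (auto simp: L2_rel_def)
  show "sgn X = inverse (norm X) *\<^sub>R X"
    by (rule sgn_L2_Rplus_def)
  show "dist X Y = norm (X - Y)"
    by (rule dist_L2_Rplus_def)
  show "uniformity = (INF e\<in>{0<..}. principal {(X, Y :: L2_Rplus). dist X Y < e})"
    by (rule uniformity_L2_Rplus_def)
  show "open U \<longleftrightarrow> (\<forall>X\<in>U. eventually (\<lambda>(X', Y). X' = X \<longrightarrow> Y \<in> U) uniformity)"
    for U :: "L2_Rplus set"
    by (rule open_L2_Rplus_def)
  show "X \<bullet> Y = Y \<bullet> X"
    by transfer (simp add: inner_commute)
  show "(X + Y) \<bullet> Z = X \<bullet> Z + Y \<bullet> Z"
    by transfer (simp add: L2_rel_def inner_add_left square_integrable_inner)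
  show "a *\<^sub>R X \<bullet> Y = a * (X \<bullet> Y)"
    by transfer (simp add: scaleR_conv_of_real[symmetric])
  show "0 \<le> X \<bullet> X"
    by transfer simp
  show "X \<bullet> X = 0 \<longleftrightarrow> X = 0"
  proof transfer
    fix f assume "L2_rel f f"
    then have f: "square_integrable f" by (simp add: L2_rel_def)
    have "(LINT r|Rplus. f r \<bullet> f r) = 0 \<longleftrightarrow> (AE r in Rplus. f r \<bullet> f r = 0)"
      by (rule integral_nonneg_eq_0_iff_AE) (auto intro: square_integrable_inner f)
    then show "(LINT r|Rplus. f r \<bullet> f r) = 0 \<longleftrightarrow> L2_rel f (\<lambda>_. 0)"
      using f by (simp add: L2_rel_def square_integrable_zero)
  qed
  show "norm X = sqrt (X \<bullet> X)"
    by transfer (simp add: power2_norm_eq_inner)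
qed

end

definition Linfty :: "real \<Rightarrow> (real \<Rightarrow> complex) set" where
  "Linfty T = {u \<in> borel_measurable (lebesgue_on {0<..<T}).
     \<exists>C. AE t in lebesgue_on {0<..<T}. cmod (u t) \<le> C}"

text \<open>
  Representatives \<open>u\<close> that agree almost everywhere on \<open>(0,T)\<close> give the same integral, so
  \<open>u\<close> need not range over equivalence classes.
\<close>

definition reach :: "real \<Rightarrow> L2_Rplus set" where
  "reach T = {abs_L2_Rplus Y | Y. square_integrable Y \<and>
     (\<exists>u\<in>Linfty T. \<forall>r>0. Y r = - (1 / complex_of_real pi) *
        (LINT \<xi>:{0<..<T}|lebesgue.
           complex_of_real (1 / (2 * \<xi>) * exp (- r / (4 * \<xi>))) * u (T - \<xi>)))}"

end

theory Submission imports Defs "HOL-Real_Asymp.Real_Asymp" begin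

text \<open>
  With \<open>s = 1 / (4 * \<xi>)\<close> the kernel is \<open>2 * s * exp (- s * r)\<close> with \<open>s > 1 / (4 * T)\<close>. Controls
  supported on short intervals yield the difference quotients
  \<open>(exp (- s * r) - exp (- (s + h) * r)) / (h * r)\<close>, which tend to \<open>exp (- s * r)\<close> in \<open>L\<^sup>2\<close> as
  \<open>h\<close> tends to \<open>0\<close>. So for fixed \<open>c > 1 / (4 * T)\<close> the closure contains \<open>x * p x\<close> with
  \<open>x = exp (- c * r)\<close> and \<open>p\<close> any complex polynomial. By Weierstrass it contains
  \<open>exp (- c * r) * \<psi> r\<close> for every continuous \<open>\<psi>\<close> vanishing for large \<open>r\<close>, and since measurable
  functions are almost everywhere limits of continuous ones, dominated convergence and truncation
  give all of \<open>L\<^sup>2\<close>.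
\<close>

section \<open>Norms and dominated convergence in \<open>L2_Rplus\<close>\<close>

lemma borel_measurable_lebesgue_onI:
  "f \<in> borel_measurable borel \<Longrightarrow> f \<in> borel_measurable (lebesgue_on S)"
  by (simp add: measurable_completion measurable_restrict_space1)

lemma norm_diff_L2:
  assumes "square_integrable f" "square_integrable g"
  shows "norm (abs_L2_Rplus f - abs_L2_Rplus g) = sqrt (LINT r|Rplus. (cmod (f r - g r))\<^sup>2)"
proof -
  \<comment> \<open>The quotient is partial, so each \<open>abs_eq\<close> rule requires its
    arguments to be self-related, that is, square integrable.\<close>
  have rel: "L2_rel f f" "L2_rel g g"
    using assms by (auto simp: L2_rel_def)
  moreover have "L2_rel (\<lambda>r. - g r) (\<lambda>r. - g r)"
    using square_integrable_scale[of g "-1"] assms by (auto simp: L2_rel_def)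
  moreover have "L2_rel (\<lambda>r. f r + - g r) (\<lambda>r. f r + - g r)"
    using square_integrable_add[of f "\<lambda>r. - g r"] square_integrable_scale[of g "-1"] assms
    by (auto simp: L2_rel_def)
  ultimately show ?thesis
    unfolding minus_L2_Rplus_def
    by (simp add: uminus_L2_Rplus.abs_eq plus_L2_Rplus.abs_eq norm_L2_Rplus.abs_eq)
qed

text \<open>Every limit argument below goes through this form of dominated convergence. The majorant
  \<open>w\<close> already makes \<open>f\<close> and all \<open>g n\<close> square integrable, so
  \<open>mem\<close> may assume this of \<open>g n\<close>; \<open>4 * (w r)\<^sup>2\<close>
  dominates the squared differences, which turns pointwise convergence into norm
  convergence.\<close>

lemma closed_L2_dominated:
  assumes S: "closed S"
    and f [measurable]: "f \<in> borel_measurable Rplus"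
    and g [measurable]: "\<And>n. g n \<in> borel_measurable Rplus"
    and w [measurable]: "w \<in> borel_measurable Rplus"
    and w2: "integrable Rplus (\<lambda>r. (w r)\<^sup>2)"
    and bound: "\<And>n. AE r in Rplus. cmod (g n r) \<le> w r"
    and lim: "AE r in Rplus. (\<lambda>n. g n r) \<longlonglongrightarrow> f r"
    and mem: "\<And>n. square_integrable (g n) \<Longrightarrow> abs_L2_Rplus (g n) \<in> S"
  shows "abs_L2_Rplus f \<in> S"
proof -
  have g_sq: "square_integrable (g n)" for n
    unfolding square_integrable_def
  proof
    show "integrable Rplus (\<lambda>r. (cmod (g n r))\<^sup>2)"
      by (rule Bochner_Integration.integrable_bound[OF w2])
         (use bound[of n] in \<open>auto elim!: eventually_mono intro!: power_mono\<close>)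
  qed (rule g)
  have "AE r in Rplus. \<forall>n. cmod (g n r) \<le> w r"
    using bound by (simp add: AE_all_countable)
  with lim have f_bound: "AE r in Rplus. cmod (f r) \<le> w r"
  proof eventually_elim
    case (elim r)
    then show ?case
      by (intro LIMSEQ_le_const2[OF tendsto_norm[OF elim(1)]]) auto
  qed
  have f_sq: "square_integrable f"
    unfolding square_integrable_def
  proof
    show "integrable Rplus (\<lambda>r. (cmod (f r))\<^sup>2)"
      by (rule Bochner_Integration.integrable_bound[OF w2])
         (use f_bound in \<open>auto elim!: eventually_mono intro!: power_mono\<close>)
  qed (rule f)
  have "(\<lambda>n. LINT r|Rplus. (cmod (g n r - f r))\<^sup>2) \<longlonglongrightarrow> (LINT r|Rplus. 0)"
  proof (rule integral_dominated_convergence)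
    show "integrable Rplus (\<lambda>r. 4 * (w r)\<^sup>2)"
      using w2 by simp
    show "AE r in Rplus. (\<lambda>n. (cmod (g n r - f r))\<^sup>2) \<longlonglongrightarrow> 0"
      using lim
    proof eventually_elim
      case (elim r)
      then have "(\<lambda>n. (cmod (g n r - f r))\<^sup>2) \<longlonglongrightarrow> (cmod (f r - f r))\<^sup>2"
        by (intro tendsto_intros)
      then show ?case by simp
    qed
    show "AE r in Rplus. norm ((cmod (g n r - f r))\<^sup>2) \<le> 4 * (w r)\<^sup>2" for n
      using bound[of n] f_bound
    proof eventually_elim
      case (elim r)
      then have "cmod (g n r - f r) \<le> 2 * w r"
        using norm_triangle_ineq4[of "g n r" "f r"] by linarith
      then have "(cmod (g n r - f r))\<^sup>2 \<le> (2 * w r)\<^sup>2"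
        by (intro power_mono) auto
      then show ?case by (simp add: power_mult_distrib)
    qed
  qed (use f g in \<open>simp_all\<close>)
  then have "(\<lambda>n. norm (abs_L2_Rplus (g n) - abs_L2_Rplus f)) \<longlonglongrightarrow> 0"
    using tendsto_real_sqrt by (fastforce simp: norm_diff_L2 g_sq f_sq)
  then have "(\<lambda>n. abs_L2_Rplus (g n)) \<longlonglongrightarrow> abs_L2_Rplus f"
    by (simp add: LIM_zero_iff tendsto_norm_zero_iff)
  with S mem[OF g_sq] show ?thesis
    by (metis closed_sequentially)
qed

section \<open>Exponential sums as limits of reachable states\<close>

lemma integrable_exp_square:
  assumes "c > 0"
  shows "integrable Rplus (\<lambda>r. (C * exp (- c * r))\<^sup>2)"
proof -
  have "(\<lambda>r. exp (- (2 * c) * r)) absolutely_integrable_on {0..}"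
    using has_integral_exp_minus_to_infinity[of "2 * c" 0] assms
    by (subst absolutely_integrable_on_iff_nonneg) (auto simp: integrable_on_def)
  then have "set_integrable lebesgue {0<..} (\<lambda>r. exp (- (2 * c) * r))"
    by (rule set_integrable_subset) auto
  then have "integrable Rplus (\<lambda>r. exp (- (2 * c) * r))"
    by (simp add: integrable_restrict_space set_integrable_def)
  then have "integrable Rplus (\<lambda>r. C\<^sup>2 * exp (- (2 * c) * r))"
    by simp
  also have "(\<lambda>r. C\<^sup>2 * exp (- (2 * c) * r)) = (\<lambda>r. (C * exp (- c * r))\<^sup>2)"
    by (simp add: fun_eq_iff power_mult_distrib exp_double[symmetric] mult.assoc)
  finally show ?thesis .
qed

lemma AE_Rplus: "(\<And>r. r > 0 \<Longrightarrow> P r) \<Longrightarrow> AE r in Rplus. P r"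
  by (rule AE_I2) simp

text \<open>Differentiating the exponent produces the factor \<open>r / (4 * \<xi>\<^sup>2)\<close>,
  so \<open>exp (- r / (4 * \<xi>)) / r\<close> is a primitive on an interval away from 0.\<close>

lemma has_bochner_integral_kernel:
  fixes \<alpha> \<beta> r :: real
  assumes "0 < \<alpha>" "\<alpha> \<le> \<beta>" "r > 0"
  shows "has_bochner_integral lborel
    (\<lambda>\<xi>. exp (- r / (4 * \<xi>)) / (4 * \<xi>\<^sup>2) * indicator {\<alpha>..\<beta>} \<xi>)
    ((exp (- r / (4 * \<beta>)) - exp (- r / (4 * \<alpha>))) / r)"
proof -
  have "has_bochner_integral lborel
    (\<lambda>\<xi>. exp (- r / (4 * \<xi>)) / (4 * \<xi>\<^sup>2) * indicator {\<alpha>..\<beta>} \<xi>)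
    (exp (- r / (4 * \<beta>)) / r - exp (- r / (4 * \<alpha>)) / r)"
  proof (rule has_bochner_integral_FTC_Icc_real)
    fix \<xi> assume "\<alpha> \<le> \<xi>" "\<xi> \<le> \<beta>"
    with assms have "\<xi> > 0" by linarith
    then show "((\<lambda>\<xi>. exp (- r / (4 * \<xi>)) / r) has_real_derivative
        exp (- r / (4 * \<xi>)) / (4 * \<xi>\<^sup>2)) (at \<xi>)"
      using assms by (auto intro!: derivative_eq_intros simp: field_simps power2_eq_square)
    show "isCont (\<lambda>\<xi>. exp (- r / (4 * \<xi>)) / (4 * \<xi>\<^sup>2)) \<xi>"
      using \<open>\<xi> > 0\<close> by (intro continuous_intros) auto
  qed fact
  then show ?thesis by (simp add: diff_divide_distrib)
qed

lemma pos_if_greater_inverse: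
  fixes c T :: real
  assumes "T > 0" "c > 1 / (4 * T)"
  shows "c > 0"
  using assms by (meson divide_pos_pos less_trans zero_less_mult_iff zero_less_numeral zero_less_one)

text \<open>
  The control \<open>u\<close> is chosen so that the integrand is the exact derivative of
  \<open>exp (- r / (4 * \<xi>)) / r\<close> on intervals of \<open>\<xi>\<close>.
\<close>

lemma exp_difference_in_reach:
  fixes a :: "nat \<Rightarrow> complex" and s :: "nat \<Rightarrow> real" and n :: nat
  defines "Y \<equiv> \<lambda>h r. \<Sum>i\<le>n. a i * complex_of_real ((exp (- s i * r) - exp (- (s i + h) * r)) / (h * r))"
  assumes T: "T > 0" and s: "\<And>i. s i > 1 / (4 * T)" and h: "h > 0"
    and Y: "square_integrable (Y h)"
  shows "abs_L2_Rplus (Y h) \<in> reach T"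
proof -
  \<comment> \<open>Under \<open>s = 1 / (4 * \<xi>)\<close> these are the values of
    \<open>\<xi>\<close> belonging to \<open>s i + h\<close> and \<open>s i\<close>; the bound
    \<open>s i > 1 / (4 * T)\<close> puts the interval between them inside (0,T).\<close>
  define \<alpha> \<beta> where "\<alpha> i = 1 / (4 * (s i + h))" and "\<beta> i = 1 / (4 * s i)" for i
  have s0: "s i > 0" for i
    by (rule pos_if_greater_inverse[OF T s])
  have ab: "0 < \<alpha> i" "\<alpha> i \<le> \<beta> i" "\<beta> i < T" for i
    using s0[of i] s[of i] h T by (auto simp: \<alpha>_def \<beta>_def field_simps)
  \<comment> \<open>At \<open>t = T - \<xi>\<close> the weight \<open>1 / (2 * \<xi>)\<close> joins
    the one in the kernel to give \<open>1 / (4 * \<xi>\<^sup>2)\<close>; \<open>- pi / h\<close>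
    cancels the prefactor \<open>- (1 / pi)\<close> and leaves the division by
    \<open>h\<close>.\<close>
  define u where "u t = (\<Sum>i\<le>n. - complex_of_real pi / h * a i *
    complex_of_real (indicator {\<alpha> i..\<beta> i} (T - t) / (2 * (T - t))))" for t
  have "u \<in> Linfty T"
    unfolding Linfty_def
  proof (intro CollectI conjI exI AE_I2)
    show "u \<in> borel_measurable (lebesgue_on {0<..<T})"
      unfolding u_def by (intro borel_measurable_lebesgue_onI) measurable
    fix t
    show "cmod (u t) \<le> (\<Sum>i\<le>n. pi / h * cmod (a i) * (1 / (2 * \<alpha> i)))"
      unfolding u_def
    proof (rule sum_norm_le)
      fix i
      \<comment> \<open>On the support \<open>T - t \<ge> \<alpha> i > 0\<close>, which keeps the
        denominator away from 0.\<close>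
      have "\<bar>indicator {\<alpha> i..\<beta> i} (T - t) / (2 * (T - t))\<bar> \<le> 1 / (2 * \<alpha> i)"
        using ab[of i] by (auto simp: indicator_def field_simps)
      then show "cmod (- complex_of_real pi / h * a i *
          complex_of_real (indicator {\<alpha> i..\<beta> i} (T - t) / (2 * (T - t))))
        \<le> pi / h * cmod (a i) * (1 / (2 * \<alpha> i))"
        unfolding norm_mult norm_of_real norm_divide norm_minus_cancel using h
        by (intro mult_mono) auto
    qed
  qed
  moreover have "Y h r = - (1 / complex_of_real pi) * (LINT \<xi>:{0<..<T}|lebesgue.
      complex_of_real (1 / (2 * \<xi>) * exp (- r / (4 * \<xi>))) * u (T - \<xi>))" if r: "r > 0" for r
  proof -
    define k where "k i \<xi> = exp (- r / (4 * \<xi>)) / (4 * \<xi>\<^sup>2) * indicator {\<alpha> i..\<beta> i} \<xi>" for i \<xi>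
    have k_meas [measurable]: "k i \<in> borel_measurable borel" for i
      unfolding k_def by measurable
    have integral_k: "has_bochner_integral lborel (k i) ((exp (- s i * r) - exp (- (s i + h) * r)) / r)" for i
    proof -
      have "- r / (4 * \<beta> i) = - s i * r" "- r / (4 * \<alpha> i) = - (s i + h) * r"
        by (simp_all add: \<alpha>_def \<beta>_def field_simps)
      then show ?thesis
        using has_bochner_integral_kernel[OF ab(1,2) r, of i] by (simp only: k_def[abs_def])
    qed
    \<comment> \<open>The indicator of (0,T) is 1 wherever some \<open>k i\<close> is nonzero, so it
      is absorbed and the integral becomes one of a Borel function over the whole line.\<close>
    have "indicator {0<..<T} \<xi> *\<^sub>R
        (complex_of_real (1 / (2 * \<xi>) * exp (- r / (4 * \<xi>))) * u (T - \<xi>))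
      = (\<Sum>i\<le>n. - complex_of_real pi / h * a i * complex_of_real (k i \<xi>))" for \<xi>
      unfolding u_def sum_distrib_left scaleR_sum_right
    proof (rule sum.cong[OF refl])
      fix i
      show "indicator {0<..<T} \<xi> *\<^sub>R (complex_of_real (1 / (2 * \<xi>) * exp (- r / (4 * \<xi>))) *
          (- complex_of_real pi / h * a i * complex_of_real
            (indicator {\<alpha> i..\<beta> i} (T - (T - \<xi>)) / (2 * (T - (T - \<xi>))))))
        = - complex_of_real pi / h * a i * complex_of_real (k i \<xi>)"
        using ab[of i] by (auto simp: k_def indicator_def power2_eq_square ac_simps)
    qed
    then have "(LINT \<xi>:{0<..<T}|lebesgue.
        complex_of_real (1 / (2 * \<xi>) * exp (- r / (4 * \<xi>))) * u (T - \<xi>))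
      = (LINT \<xi>|lborel. (\<Sum>i\<le>n. - complex_of_real pi / h * a i * complex_of_real (k i \<xi>)))"
      by (simp add: set_lebesgue_integral_def integral_completion)
    also have "\<dots> = (\<Sum>i\<le>n. - complex_of_real pi / h * a i *
        complex_of_real ((exp (- s i * r) - exp (- (s i + h) * r)) / r))"
      by (intro has_bochner_integral_integral_eq has_bochner_integral_sum
          has_bochner_integral_mult_right has_bochner_integral_of_real integral_k)
    finally show ?thesis
      by (simp only: Y_def sum_distrib_left) (intro sum.cong refl, simp)
  qed
  ultimately show ?thesis
    using Y unfolding reach_def by blast
qed

text \<open>Let \<open>h\<close> tend to 0 in the difference quotients. The common lower bound
  \<open>c\<close> on the rates gives one majorant, a multiple of \<open>exp (- c * r)\<close>, for
  all of them.\<close>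

lemma exp_sum_in_closure:
  fixes a :: "nat \<Rightarrow> complex"
  assumes T: "T > 0" and s: "\<And>i. s i \<ge> c" and c: "c > 1 / (4 * T)"
  shows "abs_L2_Rplus (\<lambda>r. \<Sum>i\<le>n. a i * complex_of_real (exp (- s i * r))) \<in> closure (reach T)"
proof -
  define q where "q h i r = (exp (- s i * r) - exp (- (s i + h) * r)) / (h * r)" for h r :: real and i
  have c0: "c > 0"
    by (rule pos_if_greater_inverse[OF T c])
  have q_bound: "\<bar>q h i r\<bar> \<le> exp (- c * r)" if "h > 0" "r > 0" for h i r
  proof -
    \<comment> \<open>The quotient factors as \<open>exp (- s i * r) * z\<close>, and
      \<open>z \<le> 1\<close> is the inequality \<open>1 - x \<le> exp (- x)\<close> at
      \<open>x = h * r\<close>.\<close>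
    define z where "z = (1 - exp (- (h * r))) / (h * r)"
    have "q h i r = exp (- s i * r) * z"
      by (simp add: q_def z_def algebra_simps exp_diff exp_minus exp_add divide_simps)
    moreover have "0 \<le> z" "z \<le> 1"
      using that exp_ge_add_one_self[of "- (h * r)"] by (auto simp: z_def field_simps)
    ultimately have "\<bar>q h i r\<bar> \<le> exp (- s i * r)"
      by (simp add: abs_mult mult_left_le)
    also have "\<dots> \<le> exp (- c * r)"
      using s[of i] that by simp
    finally show ?thesis .
  qed
  show ?thesis
  proof (rule closed_L2_dominated)
    \<comment> \<open>The step is \<open>h = 1 / Suc m\<close>, positive also for
      \<open>m = 0\<close>.\<close>
    let ?g = "\<lambda>m r. \<Sum>i\<le>n. a i * complex_of_real (q (1 / real (Suc m)) i r)"
    let ?w = "\<lambda>r. (\<Sum>i\<le>n. cmod (a i)) * exp (- c * r)"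
    show "closed (closure (reach T))" by simp
    show "(\<lambda>r. \<Sum>i\<le>n. a i * complex_of_real (exp (- s i * r))) \<in> borel_measurable Rplus"
      "?g m \<in> borel_measurable Rplus" "?w \<in> borel_measurable Rplus" for m
      unfolding q_def by (intro borel_measurable_lebesgue_onI; measurable)+
    show "integrable Rplus (\<lambda>r. (?w r)\<^sup>2)"
      using c0 by (rule integrable_exp_square)
    show "AE r in Rplus. cmod (?g m r) \<le> ?w r" for m
      unfolding sum_distrib_right
      by (intro AE_Rplus sum_norm_le) (simp add: norm_mult mult_left_mono q_bound[simplified] del: of_nat_Suc)
    show "AE r in Rplus. (\<lambda>m. ?g m r) \<longlonglongrightarrow> (\<Sum>i\<le>n. a i * complex_of_real (exp (- s i * r)))"
    proof (intro AE_Rplus tendsto_intros)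
      fix r i assume "r > (0::real)"
      then show "(\<lambda>m. q (1 / real (Suc m)) i r) \<longlonglongrightarrow> exp (- s i * r)"
        unfolding q_def by real_asymp
    qed
    show "abs_L2_Rplus (?g m) \<in> closure (reach T)" if "square_integrable (?g m)" for m
      using exp_difference_in_reach[where T = T and s = s and h = "1 / real (Suc m)" and n = n and a = a] that s c T closure_subset
      unfolding q_def by (force intro: less_le_trans)
  qed
qed

section \<open>Polynomials and continuous functions of \<open>exp (- c * r)\<close>\<close>

lemma complex_polynomial_function_sum:
  fixes p :: "real \<Rightarrow> complex"
  assumes "polynomial_function p"
  obtains a n where "p = (\<lambda>x. \<Sum>i\<le>n. a i * complex_of_real (x ^ i))"
proof -
  have "real_polynomial_function (Re \<circ> p)" "real_polynomial_function (Im \<circ> p)"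
    using assms bounded_linear_Re bounded_linear_Im unfolding polynomial_function_def by blast+
  then obtain a n b m where ab: "Re \<circ> p = (\<lambda>x. \<Sum>i\<le>n. a i * x ^ i)"
      "Im \<circ> p = (\<lambda>x. \<Sum>i\<le>m. b i * x ^ i)"
    by (auto simp: real_polynomial_function_iff_sum)
  \<comment> \<open>Real and imaginary parts may have different degrees; zero coefficients bring
    both to the common degree \<open>N\<close>.\<close>
  have pad: "(\<Sum>i\<le>n. a i * x ^ i) = (\<Sum>i\<le>N. (if i \<le> n then a i else 0) * x ^ i)"
    if "n \<le> N" for n N :: nat and a and x :: real
    using that by (intro sum.mono_neutral_cong_left) auto
  define N where "N = max n m"
  have "p x = (\<Sum>i\<le>N. Complex (if i \<le> n then a i else 0) (if i \<le> m then b i else 0)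
      * complex_of_real (x ^ i))" for x
  proof (rule complex_eqI)
    show "Re (p x) = Re (\<Sum>i\<le>N. Complex (if i \<le> n then a i else 0) (if i \<le> m then b i else 0)
        * complex_of_real (x ^ i))"
      using fun_cong[OF ab(1), of x] pad[of n N a x] by (simp add: N_def del: of_real_power)
    show "Im (p x) = Im (\<Sum>i\<le>N. Complex (if i \<le> n then a i else 0) (if i \<le> m then b i else 0)
        * complex_of_real (x ^ i))"
      using fun_cong[OF ab(2), of x] pad[of m N b x] by (simp add: N_def del: of_real_power)
  qed
  then show ?thesis
    by (intro that) (rule ext)
qed

text \<open>The substitution \<open>x = exp (- c * r)\<close> carries the half-line into [0,1],
  where Weierstrass gives uniform approximation. The factor \<open>exp (- c * r)\<close> turns
  uniform bounds into a square-integrable majorant.\<close>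

lemma exp_times_continuous_in_closure:
  fixes \<psi> :: "real \<Rightarrow> complex"
  assumes T: "T > 0" and c: "c > 1 / (4 * T)"
    and \<psi>: "continuous_on UNIV \<psi>" "\<And>r. r \<ge> R \<Longrightarrow> \<psi> r = 0"
  shows "abs_L2_Rplus (\<lambda>r. complex_of_real (exp (- c * r)) * \<psi> r) \<in> closure (reach T)"
proof -
  have c0: "c > 0"
    by (rule pos_if_greater_inverse[OF T c])
  \<comment> \<open>\<open>\<psi>\<close> in the variable \<open>x = exp (- c * r)\<close>; the \<open>max\<close> keeps \<open>ln\<close> away from \<open>0\<close> and is
    harmless because \<open>\<psi>\<close> vanishes beyond \<open>R\<close>.\<close>
  define G where "G x = \<psi> (- ln (max x (exp (- c * R))) / c)" for x
  have pos: "max x (exp (- c * R)) > 0" for x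
    by (simp add: less_max_iff_disj)
  have G_cont: "continuous_on {0..1} G"
    unfolding G_def
    by (rule continuous_on_compose2[OF \<psi>(1)])
       (use pos c0 in \<open>auto intro!: continuous_intros simp: less_le\<close>)
  have G_exp: "G (exp (- c * r)) = \<psi> r" for r
  proof (cases "r \<le> R")
    case True
    then have "max (exp (- c * r)) (exp (- c * R)) = exp (- c * r)"
      using c0 by simp
    then show ?thesis using c0 by (simp add: G_def)
  next
    \<comment> \<open>The \<open>max\<close> freezes the argument of \<open>\<psi>\<close> at
      \<open>R\<close>, and \<open>\<psi>\<close> vanishes at \<open>R\<close> itself as well as
      beyond it.\<close>
    case False
    then have "max (exp (- c * r)) (exp (- c * R)) = exp (- c * R)"
      using c0 by simp
    then show ?thesis using c0 False by (simp add: G_def \<psi>(2))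
  qed
  obtain B where B: "\<And>x. x \<in> {0..1} \<Longrightarrow> cmod (G x) \<le> B"
    using compact_imp_bounded[OF compact_continuous_image[OF G_cont compact_Icc]]
    unfolding bounded_iff by blast
  have "\<exists>p. polynomial_function p \<and> (\<forall>x\<in>{0..1}. cmod (G x - p x) < 1 / real (Suc m))" for m
    by (rule Stone_Weierstrass_polynomial_function[OF compact_Icc G_cont]) simp
  then obtain p where p: "\<And>m. polynomial_function (p m)"
      "\<And>m x. x \<in> {0..1} \<Longrightarrow> cmod (G x - p m x) < 1 / real (Suc m)"
    by metis
  have p_exp: "cmod (\<psi> r - p m (exp (- c * r))) < 1 / real (Suc m)" if "r > 0" for r m
    using p(2)[of "exp (- c * r)" m] that c0 unfolding G_exp by simp
  show ?thesis
  proof (rule closed_L2_dominated)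
    let ?g = "\<lambda>m r. complex_of_real (exp (- c * r)) * p m (exp (- c * r))"
    \<comment> \<open>\<open>B\<close> bounds \<open>G\<close> on [0,1] and each \<open>p m\<close>
      is within 1 of \<open>G\<close> there.\<close>
    let ?w = "\<lambda>r. (B + 1) * exp (- c * r)"
    show "closed (closure (reach T))" by simp
    have [measurable]: "\<psi> \<in> borel_measurable borel" "p m \<in> borel_measurable borel" for m
      using \<psi>(1) p(1) by (auto intro!: borel_measurable_continuous_onI continuous_on_polymonial_function)
    show "(\<lambda>r. complex_of_real (exp (- c * r)) * \<psi> r) \<in> borel_measurable Rplus"
      "?g m \<in> borel_measurable Rplus" "?w \<in> borel_measurable Rplus" for m
      by (intro borel_measurable_lebesgue_onI; measurable)+
    show "integrable Rplus (\<lambda>r. (?w r)\<^sup>2)"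
      using c0 by (rule integrable_exp_square)
    show "AE r in Rplus. cmod (?g m r) \<le> ?w r" for m
    proof (intro AE_Rplus)
      fix r :: real assume r: "r > 0"
      have "cmod (\<psi> r) \<le> B"
        using B[of "exp (- c * r)"] r c0 unfolding G_exp by simp
      moreover have "1 / real (Suc m) \<le> 1" by simp
      ultimately have "cmod (p m (exp (- c * r))) \<le> B + 1"
        using p_exp[OF r, of m] norm_triangle_ineq2[of "p m (exp (- c * r))" "\<psi> r"]
        by (simp only: norm_minus_commute[of "\<psi> r"])
      then show "cmod (?g m r) \<le> ?w r"
        by (simp add: norm_mult mult.commute)
    qed
    show "AE r in Rplus. (\<lambda>m. ?g m r) \<longlonglongrightarrow> complex_of_real (exp (- c * r)) * \<psi> r"
    proof (intro AE_Rplus tendsto_mult_left)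
      fix r :: real assume r: "r > 0"
      have "(\<lambda>m. p m (exp (- c * r)) - \<psi> r) \<longlonglongrightarrow> 0"
        by (rule Lim_null_comparison[OF _ LIMSEQ_Suc[OF lim_inverse_n']])
           (use p_exp[OF r] in \<open>auto simp: norm_minus_commute less_imp_le simp del: of_nat_Suc\<close>)
      then show "(\<lambda>m. p m (exp (- c * r))) \<longlonglongrightarrow> \<psi> r"
        by (simp add: LIM_zero_iff)
    qed
    show "abs_L2_Rplus (?g m) \<in> closure (reach T)" for m
    proof -
      obtain a n where a: "p m = (\<lambda>x. \<Sum>i\<le>n. a i * complex_of_real (x ^ i))"
        using complex_polynomial_function_sum[OF p(1)] .
      \<comment> \<open>The outer factor raises every power by one, so the rates are
        \<open>Suc i * c \<ge> c\<close> and even the constant term of \<open>p m\<close>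
        contributes a decaying exponential.\<close>
      have "?g m = (\<lambda>r. \<Sum>i\<le>n. a i * complex_of_real (exp (- (real (Suc i) * c) * r)))"
        unfolding a sum_distrib_left
        by (intro ext sum.cong refl)
           (simp add: exp_of_nat_mult[symmetric] exp_add[symmetric] algebra_simps flip: of_real_mult of_real_power)
      moreover have "real (Suc i) * c \<ge> c" for i
        using c0 by (simp add: mult_le_cancel_right1)
      ultimately show ?thesis
        using exp_sum_in_closure[OF T _ c] by simp
    qed
  qed
qed

section \<open>From continuous functions to all of L^2\<close>

lemma exp_bounded_in_closure:
  fixes f :: "real \<Rightarrow> complex"
  assumes T: "T > 0" and c: "c > 1 / (4 * T)"
    and f: "f \<in> borel_measurable Rplus"
    and M: "M > 0" "\<And>r. r > 0 \<Longrightarrow> cmod (f r) \<le> M * exp (- c * r)"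
  shows "abs_L2_Rplus f \<in> closure (reach T)"
proof -
  have c0: "c > 0"
    by (rule pos_if_greater_inverse[OF T c])
  \<comment> \<open>Dividing out the weight leaves a measurable function bounded by
    \<open>M\<close>, to be approximated by continuous functions.\<close>
  define q where "q r = complex_of_real (exp (c * r)) * f r" for r
  have q_bound: "cmod (q r) \<le> M" if "r > 0" for r
    using M(2)[OF that] by (simp add: q_def norm_mult exp_minus field_simps)
  have "(\<lambda>r. complex_of_real (exp (c * r))) \<in> borel_measurable Rplus"
    by (intro borel_measurable_lebesgue_onI) measurable
  then have "q \<in> borel_measurable Rplus"
    unfolding q_def using f by (rule borel_measurable_times)
  then have "q measurable_on {0<..}"
    by (simp add: measurable_on_iff_borel_measurable)
  \<comment> \<open>The continuous approximants come from the definition of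
    \<open>measurable_on\<close>; it gives them neither a common bound nor vanishing for large
    \<open>r\<close>, which \<open>\<psi>\<close> below supplies.\<close>
  then obtain N g where N: "negligible N" and g: "\<And>n. continuous_on UNIV (g n)"
      "\<And>r. r \<notin> N \<Longrightarrow> (\<lambda>n. g n r) \<longlonglongrightarrow> (if r \<in> {0<..} then q r else 0)"
    unfolding measurable_on_def by blast
  \<comment> \<open>\<open>\<kappa> n\<close> is a continuous cutoff, 1 up to \<open>n - 1\<close>
    and 0 from \<open>n\<close> on. The scaling in \<open>\<psi>\<close> is the radial retraction
    onto the disc of radius \<open>M\<close>; it fixes the limit \<open>q r\<close>, which lies in
    that disc.\<close>
  define \<kappa> where "\<kappa> n r = max 0 (min 1 (real n - r))" for n r
  define \<psi> where "\<psi> n r = \<kappa> n r *\<^sub>R (M / max M (cmod (g n r))) *\<^sub>R g n r" for n r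
  have \<psi>_cont: "continuous_on UNIV (\<psi> n)" for n
    unfolding \<psi>_def \<kappa>_def using M(1) by (auto intro!: continuous_intros g(1))
  have \<psi>_bound: "cmod (\<psi> n r) \<le> M" for n r
  proof -
    have "M * cmod (g n r) \<le> M * max M (cmod (g n r))"
      using M(1) by simp
    then have "M / max M (cmod (g n r)) * cmod (g n r) \<le> M"
      using M(1) by (simp add: field_simps max_def split: if_splits)
    moreover have "0 \<le> \<kappa> n r" "\<kappa> n r \<le> 1" by (auto simp: \<kappa>_def)
    moreover have "0 \<le> M / max M (cmod (g n r)) * cmod (g n r)"
      using M(1) by (intro mult_nonneg_nonneg divide_nonneg_nonneg) auto
    moreover have "cmod (\<psi> n r) = \<kappa> n r * (M / max M (cmod (g n r)) * cmod (g n r))"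
      using M(1) by (simp add: \<psi>_def \<kappa>_def abs_mult)
    ultimately show ?thesis
      by (metis mult_left_le_one_le order_trans)
  qed
  have \<psi>_lim: "(\<lambda>n. \<psi> n r) \<longlonglongrightarrow> q r" if r: "r > 0" "r \<notin> N" for r
  proof -
    have "(\<lambda>n. g n r) \<longlonglongrightarrow> q r"
      using g(2)[of r] r by simp
    moreover have "\<kappa> n r = 1" if "n \<ge> nat \<lceil>r + 1\<rceil>" for n
      using that by (simp add: \<kappa>_def) linarith
    then have "(\<lambda>n. \<kappa> n r) \<longlonglongrightarrow> 1"
      by (intro tendsto_eventually) (auto simp: eventually_sequentially)
    ultimately have "(\<lambda>n. \<psi> n r) \<longlonglongrightarrow> 1 *\<^sub>R (M / max M (cmod (q r))) *\<^sub>R q r"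
      unfolding \<psi>_def using M(1) by (intro tendsto_intros) auto
    then show ?thesis
      using q_bound[of r] r M(1) by (simp add: max_absorb1)
  qed
  show ?thesis
  proof (rule closed_L2_dominated)
    let ?g = "\<lambda>n r. complex_of_real (exp (- c * r)) * \<psi> n r"
    let ?w = "\<lambda>r. M * exp (- c * r)"
    show "closed (closure (reach T))" by simp
    show "f \<in> borel_measurable Rplus" by fact
    have [measurable]: "\<psi> n \<in> borel_measurable borel" for n
      using \<psi>_cont by (rule borel_measurable_continuous_onI)
    show "?g n \<in> borel_measurable Rplus" "?w \<in> borel_measurable Rplus" for n
      by (intro borel_measurable_lebesgue_onI; measurable)+
    show "integrable Rplus (\<lambda>r. (?w r)\<^sup>2)"
      using c0 by (rule integrable_exp_square)
    show "AE r in Rplus. cmod (?g n r) \<le> ?w r" for n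
      using \<psi>_bound by (simp add: norm_mult mult.commute)
    have "AE r in lebesgue. r \<notin> N"
      using N by (simp add: negligible_iff_null_sets AE_not_in)
    then have "AE r in Rplus. r > 0 \<and> r \<notin> N"
      by (auto simp: AE_restrict_space_iff)
    then show "AE r in Rplus. (\<lambda>n. ?g n r) \<longlonglongrightarrow> f r"
    proof eventually_elim
      case (elim r)
      then have "(\<lambda>n. ?g n r) \<longlonglongrightarrow> complex_of_real (exp (- c * r)) * q r"
        by (intro tendsto_mult_left \<psi>_lim) auto
      also have "complex_of_real (exp (- c * r)) * q r = f r"
        by (simp add: q_def exp_minus flip: mult.assoc of_real_mult)
      finally show ?case .
    qed
    show "abs_L2_Rplus (?g n) \<in> closure (reach T)" for n
      by (rule exp_times_continuous_in_closure[OF T c \<psi>_cont, of "real n"])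
         (simp add: \<psi>_def \<kappa>_def)
  qed
qed

text \<open>Setting \<open>f\<close> to 0 where it exceeds \<open>Suc n * exp (- c * r)\<close>
  gives exponentially bounded functions dominated by \<open>cmod (f r)\<close>. As the exponential
  is positive, at each \<open>r\<close> the truncation eventually equals \<open>f r\<close>.\<close>

lemma square_integrable_in_closure:
  assumes T: "T > 0" and f: "square_integrable f"
  shows "abs_L2_Rplus f \<in> closure (reach T)"
proof -
  define c where "c = 1 / T"
  have c: "c > 1 / (4 * T)"
    using T by (simp add: c_def field_simps)
  let ?g = "\<lambda>n r. if cmod (f r) \<le> real (Suc n) * exp (- c * r) then f r else 0"
  have [measurable]: "f \<in> borel_measurable Rplus"
    using f by (simp add: square_integrable_def)
  have [measurable]: "(\<lambda>r. exp (- c * r)) \<in> borel_measurable Rplus"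
    by (intro borel_measurable_lebesgue_onI) measurable
  have g_meas: "?g n \<in> borel_measurable Rplus" for n
    by measurable
  show ?thesis
  proof (rule closed_L2_dominated)
    show "closed (closure (reach T))" by simp
    show "f \<in> borel_measurable Rplus" "(\<lambda>r. cmod (f r)) \<in> borel_measurable Rplus" by measurable
    show "?g n \<in> borel_measurable Rplus" for n by (rule g_meas)
    show "integrable Rplus (\<lambda>r. (cmod (f r))\<^sup>2)"
      using f by (simp add: square_integrable_def)
    show "AE r in Rplus. cmod (?g n r) \<le> cmod (f r)" for n by simp
    show "AE r in Rplus. (\<lambda>n. ?g n r) \<longlonglongrightarrow> f r"
    proof (rule AE_I2)
      fix r
      obtain m where m: "cmod (f r) / exp (- c * r) \<le> real m"
        using real_arch_simple by blast
      have "cmod (f r) \<le> real (Suc n) * exp (- c * r)" if "n \<ge> m" for n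
      proof -
        have "cmod (f r) / exp (- c * r) \<le> real (Suc n)"
          using m that by linarith
        then show ?thesis by (simp only: pos_divide_le_eq exp_gt_zero)
      qed
      then show "(\<lambda>n. ?g n r) \<longlonglongrightarrow> f r"
        by (intro tendsto_eventually) (auto simp: eventually_sequentially simp del: of_nat_Suc)
    qed
    show "abs_L2_Rplus (?g n) \<in> closure (reach T)" for n
      by (rule exp_bounded_in_closure[OF T c g_meas, of "real (Suc n)"]) auto
  qed
qed

theorem theorem4p8:
  fixes T :: real
  assumes "T > 0"
  shows "closure (reach T) = (UNIV :: L2_Rplus set)"
proof -
  have "X \<in> closure (reach T)" for X
  proof -
    \<comment> \<open>In the partial quotient a chosen representative is self-related, which means
      that it is square integrable.\<close>
    have "L2_rel (rep_L2_Rplus X) (rep_L2_Rplus X)"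
      by (rule Quotient3_rep_reflp[OF Quotient3_L2_Rplus])
    then have "abs_L2_Rplus (rep_L2_Rplus X) \<in> closure (reach T)"
      by (intro square_integrable_in_closure assms) (simp add: L2_rel_def)
    then show ?thesis
      by (simp add: Quotient3_abs_rep[OF Quotient3_L2_Rplus])
  qed
  then show ?thesis by blast
qed

end
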